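(* Let $(X,d)$ be a compact metric space, let $f:X\to X$ be a continuous function, let $A$ be a non-empty nowhere dense closed subset of $X$ such that $f(A)\subseteq A$ and $f(X\setminus A)\subseteq X\setminus A$, and let $\sim$ be the equivalence relation on $X$ defined by $$x\sim y \iff x=y \text{ or } x,y\in A \qquad (x,y\in X).$$ Let $f^{\star}:X/_{\sim}\to X/_{\sim}$ be given by $f^{\star}([x])=[f(x)]$. Then the following statements are equivalent. 1. $(X,f)$ has sensitive dependence on initial conditions with respect to $A$. 2. $(X/_{\sim},f^{\star})$ has sensitive dependence on initial conditions.
   Context: A dynamical system is a pair $(X,f)$ where $X$ is a compact metric space and $f:X\to X$ is continuous. $[x]$ denotes the equivalence class of $x$, and $X/_{\sim}$ is the set of equivalence classes with the quotient topology. The map $f^{\star}$ is well defined since $f(A)\subseteq A$. The quotient topology on $X/_{\sim}$ is induced by the metric $D_A$ given by: $D_A([x],[y])=0$ if $x,y\in A$; $D_A([x],[y])=d(x,A)$ if $x\notin A,y\in A$; $D_A([x],[y])=d(A,y)$ if $x\in A,y\notin A$; and $D_A([x],[y])=\min\{d(x,y),\,d(x,A)+d(A,y)\}$ if $x,y\notin A$. Here $d(x,A)=d(A,x)=\inf\{d(a,x) : a\in A\}$. The space $X/_{\sim}$ is regarded as a compact metric space with this metric. A dynamical system $(Y,g)$, with metric $\rho$ on $Y$, has sensitive dependence on initial conditions if there is $\varepsilon>0$ such that for each $x\in Y$ and each $\delta>0$ there are $y\in Y$ with $\rho(x,y)<\delta$ and a positive integer $n$ such that $\rho(g^n(x),g^n(y))>\varepsilon$.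 For a non-empty closed $A\subseteq X$, $(X,f)$ has sensitive dependence on initial conditions with respect to $A$ if there is $\varepsilon>0$ such that for each non-empty open set $U$ in $X$ there are $x,y\in U$ and a positive integer $n$ such that $\min\{d(f^n(x),f^n(y)),\ d(f^n(x),A)+d(f^n(y),A)\}>\varepsilon$. *)

theory Defs
  imports "HOL-Analysis.Analysis"
begin

text \<open>Metric spaces are given by a carrier set and a distance function, so that the same
  notions apply to a space and to its quotient, whose points are sets.\<close>

definition dynamical_system :: "'a set \<Rightarrow> ('a \<Rightarrow> 'a \<Rightarrow> real) \<Rightarrow> ('a \<Rightarrow> 'a) \<Rightarrow> bool" where
  "dynamical_system X d f \<longleftrightarrow>
     Metric_space X d \<and>
     compact_space (Metric_space.mtopology X d) \<and>
     continuous_map (Metric_space.mtopology X d) (Metric_space.mtopology X d) f"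

definition nowhere_dense_in :: "'a topology \<Rightarrow> 'a set \<Rightarrow> bool" where
  "nowhere_dense_in T A \<longleftrightarrow> A \<subseteq> topspace T \<and> T interior_of (T closure_of A) = {}"

text \<open>This is only meaningful for non-empty \<open>A\<close>.\<close>

definition dist_to_set :: "('a \<Rightarrow> 'a \<Rightarrow> real) \<Rightarrow> 'a \<Rightarrow> 'a set \<Rightarrow> real" where
  "dist_to_set d x A = (INF a\<in>A. d a x)"

definition sensitive_dependence :: "'a set \<Rightarrow> ('a \<Rightarrow> 'a \<Rightarrow> real) \<Rightarrow> ('a \<Rightarrow> 'a) \<Rightarrow> bool" where
  "sensitive_dependence Y \<rho> g \<longleftrightarrow>
     (\<exists>\<epsilon>>0. \<forall>x\<in>Y. \<forall>\<delta>>0. \<exists>y\<in>Y. \<rho> x y < \<delta> \<and>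
        (\<exists>n::nat. n > 0 \<and> \<rho> ((g ^^ n) x) ((g ^^ n) y) > \<epsilon>))"

definition sensitive_dependence_wrt ::
    "'a set \<Rightarrow> ('a \<Rightarrow> 'a \<Rightarrow> real) \<Rightarrow> ('a \<Rightarrow> 'a) \<Rightarrow> 'a set \<Rightarrow> bool" where
  "sensitive_dependence_wrt X d f A \<longleftrightarrow>
     (\<exists>\<epsilon>>0. \<forall>U. openin (Metric_space.mtopology X d) U \<and> U \<noteq> {} \<longrightarrow>
        (\<exists>x\<in>U. \<exists>y\<in>U. \<exists>n::nat. n > 0 \<and>
           min (d ((f ^^ n) x) ((f ^^ n) y))
               (dist_to_set d ((f ^^ n) x) A + dist_to_set d ((f ^^ n) y) A) > \<epsilon>))"

definition collapse_rel :: "'a set \<Rightarrow> 'a set \<Rightarrow> ('a \<times> 'a) set" where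
  "collapse_rel X A = {(x, y). x \<in> X \<and> y \<in> X \<and> (x = y \<or> x \<in> A \<and> y \<in> A)}"

abbreviation collapse_class :: "'a set \<Rightarrow> 'a set \<Rightarrow> 'a \<Rightarrow> 'a set" where
  "collapse_class X A x \<equiv> collapse_rel X A `` {x}"

abbreviation collapse_space :: "'a set \<Rightarrow> 'a set \<Rightarrow> 'a set set" where
  "collapse_space X A \<equiv> X // collapse_rel X A"

definition collapse_dist_rep :: "('a \<Rightarrow> 'a \<Rightarrow> real) \<Rightarrow> 'a set \<Rightarrow> 'a \<Rightarrow> 'a \<Rightarrow> real" where
  "collapse_dist_rep d A x y =
     (if x \<in> A \<and> y \<in> A then 0
      else if x \<notin> A \<and> y \<in> A then dist_to_set d x A
      else if x \<in> A \<and> y \<notin> A then dist_to_set d y A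
      else min (d x y) (dist_to_set d x A + dist_to_set d y A))"

text \<open>On equivalence classes, \<open>the_elem\<close> extracts the common value obtained from all
  representatives; the lemmas \<open>collapse_dist_class\<close> and \<open>collapse_map_class\<close> below show that
  the values are indeed independent of the representatives.\<close>

definition collapse_dist :: "('a \<Rightarrow> 'a \<Rightarrow> real) \<Rightarrow> 'a set \<Rightarrow> 'a set \<Rightarrow> 'a set \<Rightarrow> real" where
  "collapse_dist d A C D = the_elem (\<Union>x\<in>C. \<Union>y\<in>D. {collapse_dist_rep d A x y})"

definition collapse_map :: "'a set \<Rightarrow> 'a set \<Rightarrow> ('a \<Rightarrow> 'a) \<Rightarrow> 'a set \<Rightarrow> 'a set" where
  "collapse_map X A f C = the_elem (\<Union>x\<in>C. {collapse_class X A (f x)})"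

lemma equiv_collapse_rel: "equiv X (collapse_rel X A)"
  by (intro equivI) (auto simp: collapse_rel_def refl_on_def sym_def trans_def)

lemma collapse_class_eq:
  assumes "A \<subseteq> X" "x \<in> X"
  shows "collapse_class X A x = (if x \<in> A then A else {x})"
  using assms by (auto simp: collapse_rel_def)

lemma collapse_dist_class:
  assumes "A \<subseteq> X" "x \<in> X" "y \<in> X"
  shows "collapse_dist d A (collapse_class X A x) (collapse_class X A y) =
           collapse_dist_rep d A x y"
proof -
  have "(\<Union>u\<in>collapse_class X A x. \<Union>v\<in>collapse_class X A y. {collapse_dist_rep d A u v}) =
        {collapse_dist_rep d A x y}"
    using assms by (auto simp: collapse_class_eq collapse_dist_rep_def)
  then show ?thesis
    by (simp add: collapse_dist_def)
qed

lemma collapse_map_class: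
  assumes "A \<subseteq> X" "f ` X \<subseteq> X" "f ` A \<subseteq> A" "x \<in> X"
  shows "collapse_map X A f (collapse_class X A x) = collapse_class X A (f x)"
proof -
  have "collapse_class X A (f u) = collapse_class X A (f x)" if "u \<in> collapse_class X A x" for u
  proof (cases "x \<in> A")
    case True
    then have "u \<in> A" using that assms by (simp add: collapse_class_eq)
    then have "f u \<in> A" "f x \<in> A" "f u \<in> X" "f x \<in> X" using True assms by auto
    then show ?thesis using assms(1) by (simp add: collapse_class_eq)
  next
    case False
    then show ?thesis using that assms by (simp add: collapse_class_eq)
  qed
  moreover have "x \<in> collapse_class X A x"
    using assms by (simp add: collapse_rel_def)
  ultimately have "(\<Union>u\<in>collapse_class X A x. {collapse_class X A (f u)}) =
      {collapse_class X A (f x)}"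
    by blast
  then show ?thesis
    by (simp add: collapse_map_def)
qed

end

theory Submission
  imports Defs
begin

text \<open>The idea is to pull everything back to \<open>X\<close>. Write \<open>p x y\<close> (below: \<open>pull_dist d A x y\<close>)
  for the number \<open>min (d x y) (d x A + d y A)\<close>. It does not distinguish the four cases in the definition of
  the quotient metric, yet it equals \<open>D\<^sub>A [x] [y]\<close> for all \<open>x\<close> and \<open>y\<close>, because a point of \<open>A\<close> has
  distance \<open>0\<close> to \<open>A\<close> and \<open>d x A \<le> d x y\<close> when \<open>y \<in> A\<close>. Since the \<open>n\<close>-th iterate of the
  quotient map sends \<open>[x]\<close> to the class of the \<open>n\<close>-th iterate at \<open>x\<close>, both kinds of
  sensitivity ask that \<open>p\<close>-distances along orbits exceed some \<open>\<epsilon>\<close>. They differ in two ways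
  only: whether one of the two orbits starts at a prescribed point, and whether closeness of the
  starting points is measured by \<open>d\<close> or by \<open>p\<close>.

  If two points of the \<open>d\<close>-ball around \<open>x\<close> become \<open>\<epsilon>\<close>-separated, then by the triangle
  inequality for \<open>p\<close> (\<open>pull_dist_triangle\<close>) one of them becomes \<open>\<epsilon>/2\<close>-separated from \<open>x\<close>; as
  \<open>p \<le> d\<close>, both are \<open>p\<close>-close to \<open>x\<close>. Conversely, a non-empty open set \<open>U\<close> contains a point
  \<open>x \<notin> A\<close> because \<open>A\<close> has empty interior. Closer to \<open>x\<close> than its distance to \<open>A\<close>, the function
  \<open>p\<close> agrees with \<open>d\<close>, so a point that is sufficiently \<open>p\<close>-close to \<open>x\<close> also lies in \<open>U\<close>.\<close>

definition pull_dist :: "('a \<Rightarrow> 'a \<Rightarrow> real) \<Rightarrow> 'a set \<Rightarrow> 'a \<Rightarrow> 'a \<Rightarrow> real" where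
  "pull_dist d A x y = min (d x y) (dist_to_set d x A + dist_to_set d y A)"

context Metric_space
begin

lemma dist_to_set_le: "a \<in> A \<Longrightarrow> dist_to_set d x A \<le> d x a"
  unfolding dist_to_set_def by (subst commute) (intro cINF_lower bdd_belowI2[of _ 0]; simp)

lemma dist_to_set_greatest:
  "A \<noteq> {} \<Longrightarrow> (\<And>a. a \<in> A \<Longrightarrow> r \<le> d x a) \<Longrightarrow> r \<le> dist_to_set d x A"
  unfolding dist_to_set_def by (intro cINF_greatest) (auto simp: commute)

lemma dist_to_set_nonneg: "A \<noteq> {} \<Longrightarrow> 0 \<le> dist_to_set d x A"
  by (rule dist_to_set_greatest) auto

lemma dist_to_set_member: "a \<in> A \<Longrightarrow> A \<subseteq> M \<Longrightarrow> dist_to_set d a A = 0"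
  using dist_to_set_le[of a A a] dist_to_set_nonneg[of A a] mdist_zero[of a] by fastforce

lemma dist_to_set_triangle:
  assumes "A \<noteq> {}" "A \<subseteq> M" "x \<in> M" "y \<in> M"
  shows "dist_to_set d x A \<le> d x y + dist_to_set d y A"
proof -
  have "dist_to_set d x A - d x y \<le> dist_to_set d y A"
  proof (rule dist_to_set_greatest[OF assms(1)])
    fix a assume "a \<in> A"
    with assms have "dist_to_set d x A \<le> d x a" "d x a \<le> d x y + d y a"
      by (auto intro: dist_to_set_le triangle)
    then show "dist_to_set d x A - d x y \<le> d y a" by simp
  qed
  then show ?thesis by simp
qed

lemma dist_to_set_pos:
  assumes "closedin mtopology A" "A \<noteq> {}" "x \<in> M - A"
  shows "0 < dist_to_set d x A"
proof -
  obtain r where r: "r > 0" "disjnt A (mball x r)"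
    using assms by (auto simp: closedin_metric)
  have "r \<le> dist_to_set d x A"
  proof (rule dist_to_set_greatest[OF assms(2)])
    fix a assume "a \<in> A"
    moreover have "A \<subseteq> M" using assms(1) by (simp add: closedin_metric)
    ultimately show "r \<le> d x a" using r(2) assms(3) by (force simp: disjnt_iff)
  qed
  with r(1) show ?thesis by simp
qed

text \<open>A path from \<open>x\<close> to \<open>z\<close> through \<open>y\<close> may use the shortcut through \<open>A\<close> on neither, one or
  both of its two legs. One shortcut gives a shortcut for \<open>x\<close> and \<open>z\<close>, because \<open>d _ A\<close> is
  \<open>1\<close>-Lipschitz; of two shortcuts, the part leading to \<open>y\<close> and back is dropped.\<close>

lemma pull_dist_triangle:
  assumes "A \<noteq> {}" "A \<subseteq> M" "x \<in> M" "y \<in> M" "z \<in> M"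
  shows "pull_dist d A x z \<le> pull_dist d A x y + pull_dist d A y z"
  using triangle[OF assms(3-5)] dist_to_set_nonneg[OF assms(1), of y]
    dist_to_set_triangle[OF assms(1,2,3,4)] dist_to_set_triangle[OF assms(1,2,5,4)]
  unfolding pull_dist_def by (simp add: commute min_def)

lemma pull_dist_commute: "pull_dist d A x y = pull_dist d A y x"
  by (simp add: pull_dist_def commute add.commute)

lemma collapse_dist_rep_eq_pull_dist:
  assumes "A \<subseteq> M"
  shows "collapse_dist_rep d A x y = pull_dist d A x y"
  using dist_to_set_le[of y A x] dist_to_set_le[of x A y] dist_to_set_member[OF _ assms]
  by (auto simp: collapse_dist_rep_def pull_dist_def commute)

lemma collapse_dist_eq_pull_dist:
  assumes "A \<subseteq> M" "x \<in> M" "y \<in> M"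
  shows "collapse_dist d A (collapse_class M A x) (collapse_class M A y) = pull_dist d A x y"
  by (simp add: collapse_dist_class[OF assms] collapse_dist_rep_eq_pull_dist[OF assms(1)])

end

lemma funpow_mem: "f ` X \<subseteq> X \<Longrightarrow> x \<in> X \<Longrightarrow> (f ^^ n) x \<in> X"
  by (induction n) auto

lemma funpow_collapse_map:
  assumes "A \<subseteq> X" "f ` X \<subseteq> X" "f ` A \<subseteq> A" "x \<in> X"
  shows "(collapse_map X A f ^^ n) (collapse_class X A x) = collapse_class X A ((f ^^ n) x)"
proof (induction n)
  case (Suc n)
  then show ?case
    using collapse_map_class[OF assms(1-3) funpow_mem[OF assms(2,4), of n]] by simp
qed simp

text \<open>Every class has a representative, and neither \<open>pull_dist\<close> nor the iterates depend on its
  choice. So the quotient can be eliminated, and the two kinds of sensitivity can be compared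
  along orbits of \<open>f\<close> itself.\<close>

lemma (in Metric_space) sensitive_dependence_collapse_iff:
  assumes "A \<subseteq> M" "f ` M \<subseteq> M" "f ` A \<subseteq> A"
  shows "sensitive_dependence (collapse_space M A) (collapse_dist d A) (collapse_map M A f) \<longleftrightarrow>
    (\<exists>\<epsilon>>0. \<forall>x\<in>M. \<forall>\<delta>>0. \<exists>y\<in>M. pull_dist d A x y < \<delta> \<and>
       (\<exists>n>0. pull_dist d A ((f ^^ n) x) ((f ^^ n) y) > \<epsilon>))"
proof -
  have space: "collapse_space M A = collapse_class M A ` M"
    by (auto simp: quotient_def)
  show ?thesis
    by (simp add: sensitive_dependence_def space funpow_collapse_map funpow_mem
        collapse_dist_eq_pull_dist assms cong: conj_cong)
qed

text \<open>Non-empty open sets are replaced by balls around points outside \<open>A\<close>; this is where \<open>A\<close>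
  must have empty interior. The radius stays below the distance to \<open>A\<close>, which rules out that
  \<open>pull_dist\<close> is small because of the shortcut through \<open>A\<close>.\<close>

lemma (in Metric_space) pull_dist_ball_in_open:
  assumes A: "A \<noteq> {}" "closedin mtopology A" "nowhere_dense_in mtopology A"
    and U: "openin mtopology U" "U \<noteq> {}"
  obtains x \<delta> where "x \<in> U" "\<delta> > 0" "\<And>y. y \<in> M \<Longrightarrow> pull_dist d A x y < \<delta> \<Longrightarrow> y \<in> U"
proof -
  have "mtopology interior_of A = {}"
    using A(2,3) by (simp add: nowhere_dense_in_def closure_of_closedin)
  then have "\<not> U \<subseteq> A"
    using U interior_of_maximal by blast
  then obtain x where x: "x \<in> U" "x \<notin> A" by blast
  then have xM: "x \<in> M" using U(1) by (auto simp: openin_mtopology)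
  obtain r where r: "r > 0" "mball x r \<subseteq> U"
    using U(1) x(1) by (auto simp: openin_mtopology)
  define \<delta> where "\<delta> = min r (dist_to_set d x A)"
  show thesis
  proof
    show "x \<in> U" by fact
    show "\<delta> > 0" using r(1) dist_to_set_pos[OF A(2,1)] xM x(2) by (simp add: \<delta>_def)
  next
    fix y assume y: "y \<in> M" "pull_dist d A x y < \<delta>"
    then have "d x y < r"
      using dist_to_set_nonneg[OF A(1), of y] by (auto simp: pull_dist_def \<delta>_def min_def split: if_splits)
    then show "y \<in> U" using r(2) xM y(1) by auto
  qed
qed

theorem theorem3p15:
  fixes X A :: "'a set" and d :: "'a \<Rightarrow> 'a \<Rightarrow> real" and f :: "'a \<Rightarrow> 'a"
  assumes "dynamical_system X d f"
    and "A \<noteq> {}"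
    and "closedin (Metric_space.mtopology X d) A"
    and "nowhere_dense_in (Metric_space.mtopology X d) A"
    and "f ` A \<subseteq> A"
    and "f ` (X - A) \<subseteq> X - A"
  shows "sensitive_dependence_wrt X d f A \<longleftrightarrow>
         sensitive_dependence (collapse_space X A) (collapse_dist d A) (collapse_map X A f)"
proof -
  interpret Metric_space X d
    using assms(1) by (simp add: dynamical_system_def)
  have AX: "A \<subseteq> X" using assms(3) by (simp add: closedin_metric)
  then have fX: "f ` X \<subseteq> X" using assms(5,6) by blast
  note triangle_p = pull_dist_triangle[OF assms(2) AX]
  note wrt_def = sensitive_dependence_wrt_def[of X d f A, folded pull_dist_def]
  show ?thesis
    unfolding sensitive_dependence_collapse_iff[OF AX fX assms(5)]
  proof
    assume "sensitive_dependence_wrt X d f A"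
    then obtain \<epsilon> where \<epsilon>: "\<epsilon> > 0" and sep: "\<And>U. openin mtopology U \<Longrightarrow> U \<noteq> {} \<Longrightarrow>
        \<exists>y\<in>U. \<exists>z\<in>U. \<exists>n>0. pull_dist d A ((f ^^ n) y) ((f ^^ n) z) > \<epsilon>"
      unfolding wrt_def by blast
    have "\<exists>y\<in>X. pull_dist d A x y < \<delta> \<and>
        (\<exists>n>0. pull_dist d A ((f ^^ n) x) ((f ^^ n) y) > \<epsilon> / 2)"
      if x: "x \<in> X" and \<delta>: "\<delta> > 0" for x \<delta>
    proof -
      have "mball x \<delta> \<noteq> {}" using x \<delta> by (metis centre_in_mball_iff empty_iff)
      from sep[OF openin_mball this] obtain y z n
        where yz: "y \<in> mball x \<delta>" "z \<in> mball x \<delta>" and n: "n > 0"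
          and far: "pull_dist d A ((f ^^ n) y) ((f ^^ n) z) > \<epsilon>" by blast
      have near: "w \<in> X \<and> pull_dist d A x w < \<delta>" if "w \<in> mball x \<delta>" for w
        using that by (auto simp: pull_dist_def)
      have "pull_dist d A ((f ^^ n) y) ((f ^^ n) z)
          \<le> pull_dist d A ((f ^^ n) y) ((f ^^ n) x) + pull_dist d A ((f ^^ n) x) ((f ^^ n) z)"
        using near[OF yz(1)] near[OF yz(2)] x by (intro triangle_p funpow_mem fX) auto
      with far have "pull_dist d A ((f ^^ n) x) ((f ^^ n) y) > \<epsilon> / 2 \<or>
          pull_dist d A ((f ^^ n) x) ((f ^^ n) z) > \<epsilon> / 2"
        by (auto simp: pull_dist_commute[of A "(f ^^ n) y" "(f ^^ n) x"])
      then show ?thesis using near[OF yz(1)] near[OF yz(2)] n by blast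
    qed
    with \<epsilon> show "\<exists>\<epsilon>>0. \<forall>x\<in>X. \<forall>\<delta>>0. \<exists>y\<in>X. pull_dist d A x y < \<delta> \<and>
        (\<exists>n>0. pull_dist d A ((f ^^ n) x) ((f ^^ n) y) > \<epsilon>)"
      by (intro exI[of _ "\<epsilon> / 2"]) auto
  next
    assume "\<exists>\<epsilon>>0. \<forall>x\<in>X. \<forall>\<delta>>0. \<exists>y\<in>X. pull_dist d A x y < \<delta> \<and>
        (\<exists>n>0. pull_dist d A ((f ^^ n) x) ((f ^^ n) y) > \<epsilon>)"
    then obtain \<epsilon> where \<epsilon>: "\<epsilon> > 0" and sep: "\<And>x \<delta>. x \<in> X \<Longrightarrow> \<delta> > 0 \<Longrightarrow>
        \<exists>y\<in>X. pull_dist d A x y < \<delta> \<and>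
          (\<exists>n>0. pull_dist d A ((f ^^ n) x) ((f ^^ n) y) > \<epsilon>)" by blast
    have "\<exists>x\<in>U. \<exists>y\<in>U. \<exists>n>0. pull_dist d A ((f ^^ n) x) ((f ^^ n) y) > \<epsilon>"
      if U: "openin mtopology U" "U \<noteq> {}" for U
    proof -
      obtain x \<delta> where x: "x \<in> U" and \<delta>: "\<delta> > 0"
        and ball: "\<And>y. y \<in> X \<Longrightarrow> pull_dist d A x y < \<delta> \<Longrightarrow> y \<in> U"
        using pull_dist_ball_in_open[OF assms(2-4) U] by blast
      have "x \<in> X" using x U(1) by (auto simp: openin_mtopology)
      from sep[OF this \<delta>] show ?thesis using x ball by blast
    qed
    with \<epsilon> show "sensitive_dependence_wrt X d f A"
      unfolding wrt_def by blast
  qed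
qed

end
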